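(* Let $d$ be a fixed positive integer. As $n\to\infty$, both $f(n,d)=d\log_2 n+O(1)$ and $g(n,d)=d\log_2 n+O(1)$, where $f(n,d)$ and $g(n,d)$ are the minimal numbers of queries needed in the non-adaptive and the adaptive parity search problem, respectively. The implied constants may depend on $d$ but not on $n$.
   Context: Write $[n]=\{1,2,\ldots,n\}$. In the parity search problem there is an unknown set $X\subseteq[n]$ of marked items, known in advance only to satisfy $|X|\le d$. A query consists of specifying a subset $A\subseteq[n]$, and its answer is the parity of $|A\cap X|$. The task is to determine $X$. Non-adaptive version: all query sets must be specified before the first answer is received. Thus $f(n,d)$ is the least integer $f$ such that there exist $f$ subsets $A_1,\ldots,A_f$ of $[n]$ with the property that for any two distinct subsets $X,Y$ of $[n]$ of size at most $d$ there is an index $i\in[f]$ for which $|A_i\cap X|$ and $|A_i\cap Y|$ have different parity. Adaptive version: each query set may depend on the answers to all previous queries. Thus $g(n,d)$ is the least integer $g$ such that there is a deterministic strategy, choosing each query set as a function of the answers to the previous queries, that for every $X\subseteq[n]$ with $|X|\le d$ makes at most $g$ queries and whose answers determine $X$ uniquely among all subsets of $[n]$ of size at most $d$. *)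

theory Defs
  imports Complex_Main "HOL-Library.Landau_Symbols"
begin

definition candidates :: "nat \<Rightarrow> nat \<Rightarrow> nat set set" where
  "candidates n d = {X. X \<subseteq> {1..n} \<and> card X \<le> d}"

text \<open>The answer to the query \<open>A\<close>: \<open>True\<close> stands for odd parity.\<close>

definition parity_answer :: "nat set \<Rightarrow> nat set \<Rightarrow> bool" where
  "parity_answer X A \<longleftrightarrow> odd (card (A \<inter> X))"

definition nonadaptive_solvable :: "nat \<Rightarrow> nat \<Rightarrow> nat \<Rightarrow> bool" where
  "nonadaptive_solvable n d m \<longleftrightarrow>
     (\<exists>A :: nat \<Rightarrow> nat set.
        (\<forall>i\<in>{1..m}. A i \<subseteq> {1..n}) \<and>
        (\<forall>X\<in>candidates n d. \<forall>Y\<in>candidates n d. X \<noteq> Y \<longrightarrow>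
           (\<exists>i\<in>{1..m}. parity_answer X (A i) \<noteq> parity_answer Y (A i))))"

definition nonadaptive_number :: "nat \<Rightarrow> nat \<Rightarrow> nat" where
  "nonadaptive_number n d = (LEAST m. nonadaptive_solvable n d m)"

text \<open>
  A deterministic adaptive strategy is a decision tree: \<open>Ask A s\<close> queries \<open>A\<close> and continues
  with \<open>s b\<close> on receiving the answer \<open>b\<close>. The query at a node thus depends exactly on the
  answers received on the way to it, and the number of queries made may depend on the marked set.
\<close>

datatype strategy = Stop | Ask "nat set" "bool \<Rightarrow> strategy"

primrec queries_within :: "nat \<Rightarrow> strategy \<Rightarrow> bool" where
  "queries_within n Stop \<longleftrightarrow> True"
| "queries_within n (Ask A s) \<longleftrightarrow> A \<subseteq> {1..n} \<and> (\<forall>b. queries_within n (s b))"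

primrec answers :: "strategy \<Rightarrow> nat set \<Rightarrow> bool list" where
  "answers Stop X = []"
| "answers (Ask A s) X = parity_answer X A # answers (s (parity_answer X A)) X"

definition adaptive_solvable :: "nat \<Rightarrow> nat \<Rightarrow> nat \<Rightarrow> bool" where
  "adaptive_solvable n d m \<longleftrightarrow>
     (\<exists>s. queries_within n s \<and>
        (\<forall>X\<in>candidates n d. length (answers s X) \<le> m) \<and>
        inj_on (answers s) (candidates n d))"

definition adaptive_number :: "nat \<Rightarrow> nat \<Rightarrow> nat" where
  "adaptive_number n d = (LEAST m. adaptive_solvable n d m)"

text \<open>Both minima are taken over nonempty sets: querying all singletons always succeeds.\<close>

lemma parity_answer_singleton: "parity_answer X {i} \<longleftrightarrow> i \<in> X"
  by (cases "i \<in> X") (simp_all add: parity_answer_def)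

lemma nonadaptive_solvable_exists: "nonadaptive_solvable n d n"
  unfolding nonadaptive_solvable_def
proof (intro exI[of _ "\<lambda>i. {i}"] conjI ballI impI)
  fix X Y assume "X \<in> candidates n d" "Y \<in> candidates n d" "X \<noteq> Y"
  then show "\<exists>i\<in>{1..n}. parity_answer X {i} \<noteq> parity_answer Y {i}"
    unfolding parity_answer_singleton candidates_def by blast
qed auto

lemma adaptive_solvable_exists: "adaptive_solvable n d n"
proof -
  define T where "T = rec_nat Stop (\<lambda>k s. Ask {Suc k} (\<lambda>_. s))"
  have T: "T 0 = Stop" "T (Suc k) = Ask {Suc k} (\<lambda>_. T k)" for k
    by (simp_all add: T_def)
  have within: "k \<le> n \<Longrightarrow> queries_within n (T k)" for k
    by (induction k) (auto simp: T)
  have len: "length (answers (T k) X) = k" for k X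
    by (induction k) (auto simp: T)
  have det: "answers (T k) X = answers (T k) Y \<Longrightarrow> X \<inter> {1..k} = Y \<inter> {1..k}" for k X Y
    by (induction k) (auto simp: T parity_answer_singleton atLeastAtMostSuc_conv)
  have "inj_on (answers (T n)) (candidates n d)"
  proof (rule inj_onI)
    fix X Y assume "X \<in> candidates n d" "Y \<in> candidates n d" "answers (T n) X = answers (T n) Y"
    then show "X = Y"
      using det[of n X Y] by (auto simp: candidates_def)
  qed
  then show ?thesis
    unfolding adaptive_solvable_def using within len by (metis order_refl)
qed

end

theory Submission
  imports Defs "HOL-Algebra.Algebraic_Closure_Type" "HOL-Library.Z2"
begin

text \<open>
  The two quantities are squeezed between the same bounds:
  \<open>d log n - d log d - 1 \<le> g(n,d) \<le> f(n,d) \<le> d log n + d\<close> for \<open>n \<ge> d\<close>.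

  The lower bound is information-theoretic: a strategy with at most \<open>m\<close> queries has fewer than
  \<open>2^(m+1)\<close> possible transcripts, and these must separate at least \<open>(n choose d) \<ge> (n/d)^d\<close>
  candidates. The middle inequality holds because asking a fixed list of queries in turn is a
  strategy.

  The upper bound is the parity check matrix of a binary BCH code. Let \<open>2^m\<close> be the least power of
  two above \<open>n\<close> and label the items by distinct nonzero elements \<open>a\<^sub>x\<close> of the field with \<open>2^m\<close>
  elements. The queries reveal the coordinates, over the two-element field, of the power sums
  \<open>\<Sum>x\<in>U. a\<^sub>x^j\<close> for the \<open>d\<close> odd exponents \<open>j < 2 * d\<close>; that is \<open>d * m\<close> queries in all. If \<open>U\<close> and
  \<open>W\<close> give the same answers, then these power sums vanish on the symmetric difference of \<open>U\<close> and
  \<open>W\<close>, which has at most \<open>2 * d\<close> elements. Squaring is additive in characteristic two, so the power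
  sums with even exponents at most \<open>2 * d\<close> vanish as well, and a Vandermonde argument
  (\<open>odd_power_sums_vanish_imp_empty\<close>) shows that the symmetric difference is empty.

  The field with \<open>2^m\<close> elements is realised as the set of roots of \<open>x^(2^m) - x\<close> in the algebraic
  closure of the two-element field.
\<close>

section \<open>Power sums in characteristic two\<close>

text \<open>
  Odd exponents suffice because the power sum with exponent \<open>2 * j\<close> is the square of the one with
  exponent \<open>j\<close>. This is what halves the number of queries from \<open>2 d log n\<close>
  to \<open>d log n\<close>.
\<close>

lemma power_sums_vanish:
  fixes T :: "'a::idom set"
  assumes char: "CHAR('a) = 2"
    and odd: "\<And>j. j < d \<Longrightarrow> (\<Sum>a\<in>T. a ^ (2 * j + 1)) = 0"
    and "0 < i" "i \<le> 2 * d"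
  shows "(\<Sum>a\<in>T. a ^ i) = 0"
  using assms(3,4)
proof (induction i rule: less_induct)
  case (less i)
  show ?case
  proof (cases "even i")
    case True
    then obtain j where j: "i = 2 * j" by blast
    have "(\<Sum>a\<in>T. a ^ i) = (\<Sum>a\<in>T. a ^ j) ^ 2"
      using char by (subst freshmans_dream_sum) (simp_all add: j power_mult mult.commute)
    also have "(\<Sum>a\<in>T. a ^ j) = 0"
      using less j by auto
    finally show ?thesis by simp
  next
    case False
    then obtain j where "i = 2 * j + 1" by (rule oddE)
    then show ?thesis using odd[of j] less.prems by simp
  qed
qed

text \<open>
  The vanishing of the power sums says that \<open>\<Sum>a\<in>T. f a = 0\<close> for every polynomial \<open>f\<close> of degree at
  most \<open>2 * d\<close> without constant term. For \<open>f = X * (\<Prod>b\<in>T - {a}. X - b)\<close> with \<open>a\<close> in \<open>T\<close>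
  only the summand \<open>f a \<noteq> 0\<close> survives.
\<close>

lemma odd_power_sums_vanish_imp_empty:
  fixes T :: "'a::idom set"
  assumes char: "CHAR('a) = 2" and fin: "finite T" and "0 \<notin> T" and card: "card T \<le> 2 * d"
    and odd: "\<And>j. j < d \<Longrightarrow> (\<Sum>a\<in>T. a ^ (2 * j + 1)) = 0"
  shows "T = {}"
proof (rule ccontr)
  assume "T \<noteq> {}"
  then obtain a where a: "a \<in> T" by blast
  define f where "f = [:0, 1:] * (\<Prod>b\<in>T - {a}. [:- b, 1:])"
  have f: "poly f x = x * (\<Prod>b\<in>T - {a}. x - b)" for x
    by (simp add: f_def poly_prod)
  have "Polynomial.degree (\<Prod>b\<in>T - {a}. [:- b, 1:]) \<le> (\<Sum>b\<in>T - {a}. Polynomial.degree [:- b, 1:])"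
    using degree_prod_sum_le[of "T - {a}" "\<lambda>b. [:- b, 1:]"] fin by (simp add: o_def)
  also have "\<dots> = card T - 1"
    using a fin by simp
  finally have deg: "Polynomial.degree f \<le> 2 * d"
    using degree_mult_le[of "[:0, 1:]" "\<Prod>b\<in>T - {a}. [:- b, 1:]"] card a fin
      card_gt_0_iff[of T] by (auto simp: f_def)
  have "(\<Sum>x\<in>T. poly f x) = (\<Sum>x\<in>T. \<Sum>i\<le>Polynomial.degree f. Polynomial.coeff f i * x ^ i)"
    by (simp add: poly_altdef)
  also have "\<dots> = (\<Sum>i\<le>Polynomial.degree f. Polynomial.coeff f i * (\<Sum>x\<in>T. x ^ i))"
    by (subst sum.swap) (simp add: sum_distrib_left)
  also have "\<dots> = 0"
  proof (rule sum.neutral, rule ballI)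
    fix i assume i: "i \<in> {..Polynomial.degree f}"
    show "Polynomial.coeff f i * (\<Sum>x\<in>T. x ^ i) = 0"
    proof (cases "i = 0")
      case True
      have "Polynomial.coeff f 0 = 0" using f[of 0] by (simp add: poly_0_coeff_0)
      then show ?thesis using True by simp
    next
      case False
      then have "(\<Sum>x\<in>T. x ^ i) = 0"
        using power_sums_vanish[OF char odd] i deg by auto
      then show ?thesis by simp
    qed
  qed
  finally have "(\<Sum>x\<in>T. poly f x) = 0" .
  moreover have "(\<Sum>x\<in>T. poly f x) = poly f a + (\<Sum>x\<in>T - {a}. poly f x)"
    using fin a by (rule sum.remove)
  moreover have "(\<Sum>x\<in>T - {a}. poly f x) = 0"
  proof (rule sum.neutral, rule ballI)
    fix x assume "x \<in> T - {a}"
    then have "(\<Prod>b\<in>T - {a}. x - b) = 0"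
      using fin by (intro prod_zero) auto
    then show "poly f x = 0" by (simp add: f)
  qed
  moreover have "poly f a \<noteq> 0"
    using fin a \<open>0 \<notin> T\<close> by (auto simp: f prod_zero_iff)
  ultimately show False by simp
qed

section \<open>The field with \<open>2^m\<close> elements\<close>

text \<open>
  A repeated entry in the multiset of roots would give a double root, hence a common root with the
  derivative.
\<close>

lemma card_roots_of_separable:
  fixes p :: "'a::alg_closed_field poly"
  assumes "p \<noteq> 0" and sep: "\<And>x. poly p x = 0 \<Longrightarrow> poly (pderiv p) x \<noteq> 0"
  shows "card {x. poly p x = 0} = Polynomial.degree p"
proof -
  obtain A where A: "size A = Polynomial.degree p"
      "p = smult (lead_coeff p) (\<Prod>x\<in>#A. [:-x, 1:])"
    using alg_closed_imp_factorization[OF \<open>p \<noteq> 0\<close>] by blast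
  have "count A x \<le> 1" for x
  proof (rule ccontr)
    assume "\<not> count A x \<le> 1"
    then have "{#x, x#} \<subseteq># A"
      by (simp add: subseteq_mset_def)
    then obtain B where "A = {#x, x#} + B"
      by (metis subset_mset.add_diff_inverse)
    then have "\<exists>q. p = [:-x, 1:] * ([:-x, 1:] * q)"
      using A(2) by (metis (no_types, lifting) add_mset_add_single image_mset_add_mset
          mult_smult_right prod_mset.add_mset union_mset_add_mset_left add_mset_commute empty_neutral(1))
    then obtain q where q: "p = [:-x, 1:] * ([:-x, 1:] * q)" by blast
    have "poly p x = 0" "poly (pderiv p) x = 0"
      unfolding q pderiv_mult by simp_all
    with sep show False by blast
  qed
  then have "A = mset_set (set_mset A)"
    by (intro multiset_eqI) (metis count_greater_eq_one_iff count_mset_set(1) count_mset_set(3)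
        finite_set_mset le_antisym not_in_iff)
  then have "size A = card (set_mset A)"
    by (metis size_mset_set)
  moreover have "{x. poly p x = 0} = set_mset A"
  proof -
    have "poly p x = lead_coeff p * (\<Prod>a\<in>#A. x - a)" for x
      by (subst A(2)) (simp add: poly_prod_mset image_mset.compositionality o_def)
    then show ?thesis
      using \<open>p \<noteq> 0\<close> by auto
  qed
  ultimately show ?thesis using A(1) by simp
qed

text \<open>The derivative of \<open>X^(2^m) - X\<close> is the constant \<open>-1\<close>, hence all roots are simple.\<close>

lemma card_frobenius_fixed:
  assumes char: "CHAR('a::alg_closed_field) = 2" and "m > 0"
  shows "card {x::'a. x ^ (2 ^ m) = x} = 2 ^ m"
proof -
  define p where "p = Polynomial.monom (1::'a) (2 ^ m) - [:0, 1:]"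
  have p: "poly p x = x ^ (2 ^ m) - x" for x
    by (simp add: p_def poly_monom)
  have gt: "(1::nat) < 2 ^ m" using \<open>m > 0\<close> by (intro one_less_power) simp_all
  have deg: "Polynomial.degree p = 2 ^ m"
    unfolding p_def diff_conv_add_uminus using gt
    by (subst degree_add_eq_left) (simp_all add: degree_monom_eq)
  have "(of_nat (2 ^ m) :: 'a) = 0"
    using char \<open>m > 0\<close> by (simp only: of_nat_eq_0_iff_char_dvd) simp
  then have "pderiv (Polynomial.monom (1::'a) (2 ^ m)) = 0"
    unfolding pderiv_monom by (metis monom_eq_0 mult_zero_left)
  then have "poly (pderiv p) x = - 1" for x
    by (simp add: p_def pderiv_diff pderiv_pCons)
  then have "card {x. poly p x = 0} = Polynomial.degree p"
    using deg by (intro card_roots_of_separable) auto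
  then show ?thesis by (simp add: p deg)
qed

section \<open>Coordinates over the two-element field\<close>

text \<open>
  A finite elementary abelian 2-group of order at most \<open>2^m\<close> has at most \<open>m\<close> coordinates: it is a
  vector space over the two-element field, and the sums over the subsets of a basis are distinct.
\<close>

lemma binary_coordinates:
  fixes V :: "'a::ab_group_add set"
  assumes double: "\<And>x::'a. x + x = 0"
    and V: "finite V" "card V \<le> 2 ^ m" "0 \<in> V" "\<And>x y. x \<in> V \<Longrightarrow> y \<in> V \<Longrightarrow> x + y \<in> V"
  shows "\<exists>\<phi> :: nat \<Rightarrow> 'a \<Rightarrow> bit.
    (\<forall>k. \<forall>x\<in>V. \<forall>y\<in>V. \<phi> k (x + y) = \<phi> k x + \<phi> k y) \<and>
    (\<forall>x\<in>V. \<forall>y\<in>V. (\<forall>k<m. \<phi> k x = \<phi> k y) \<longrightarrow> x = y)"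
proof -
  define scale where "scale c x = (if c = 1 then x else 0)" for c :: bit and x :: 'a
  interpret vector_space scale
  proof
    fix a b :: bit and x y :: 'a
    show "scale (a + b) x = scale a x + scale b x"
      by (cases a; cases b) (simp_all add: scale_def double)
  qed (auto simp: scale_def)
  have sub: "subspace V"
    using V by (auto simp: subspace_def scale_def)
  obtain B where B: "B \<subseteq> V" "independent B" "V \<subseteq> span B"
    using maximal_independent_subset by blast
  have span: "span B = V"
    using B sub by (simp add: span_minimal subset_antisym)
  have finB: "finite B" using B(1) V(1) by (rule finite_subset)
  have ind: "inj_on (\<lambda>S. \<Sum>b\<in>S. b) (Pow B)"
  proof (rule inj_onI)
    fix S T assume S: "S \<in> Pow B" "T \<in> Pow B" and eq: "(\<Sum>b\<in>S. b) = (\<Sum>b\<in>T. b)"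
    have conv: "(\<Sum>b\<in>S. b) = (\<Sum>b\<in>B. scale (if b \<in> S then 1 else 0) b)" if "S \<subseteq> B" for S
      using that finB by (intro sum.mono_neutral_cong_left) (auto simp: scale_def)
    have "(\<Sum>b\<in>B. scale ((if b \<in> S then 1 else 0) - (if b \<in> T then 1 else 0)) b) = 0"
      using S eq by (simp only: scale_left_diff_distrib sum_subtractf) (simp add: conv)
    then have "(if b \<in> S then 1 else 0) - (if b \<in> T then 1 else 0) = (0::bit)" if "b \<in> B" for b
      using independentD[OF B(2) finB subset_refl _ that,
          of "\<lambda>b. (if b \<in> S then 1 else 0) - (if b \<in> T then 1 else 0)"] by simp
    then have "b \<in> S \<longleftrightarrow> b \<in> T" if "b \<in> B" for b
      using that by (metis diff_0_right right_minus_eq zero_neq_one)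
    then show "S = T" using S by auto
  qed
  have "(\<lambda>S. \<Sum>b\<in>S. b) ` Pow B \<subseteq> V"
    using B(1) sub by (auto intro!: subspace_sum)
  then have "card (Pow B) \<le> card V"
    using card_inj_on_le[OF ind] V(1) by blast
  then have "(2::nat) ^ card B \<le> 2 ^ m"
    using V(2) card_Pow[OF finB] by linarith
  then have cardB: "card B \<le> m"
    by (rule power_le_imp_le_exp[rotated]) simp
  obtain e where e: "bij_betw e {0..<card B} B"
    using ex_bij_betw_nat_finite[OF finB] by blast
  show ?thesis
  proof (intro exI[of _ "\<lambda>k x. representation B x (e k)"] conjI allI ballI impI)
    show "representation B (x + y) (e k) = representation B x (e k) + representation B y (e k)"
      if "x \<in> V" "y \<in> V" for k x y
      using representation_add[OF B(2)] that by (simp add: span)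
    show "x = y" if xy: "x \<in> V" "y \<in> V"
      and eq: "\<forall>k<m. representation B x (e k) = representation B y (e k)" for x y
    proof -
      have "representation B x b = representation B y b" if "b \<in> B" for b
      proof -
        have "b \<in> e ` {0..<card B}"
          using that bij_betw_imp_surj_on[OF e] by (simp only:)
        then obtain k where "k < card B" "b = e k"
          by auto
        then show ?thesis using eq cardB by simp
      qed
      then have "(\<Sum>b\<in>B. scale (representation B x b) b) = (\<Sum>b\<in>B. scale (representation B y b) b)"
        by simp
      then show "x = y"
        using xy by (simp add: sum_representation_eq[OF B(2)] span finB)
    qed
  qed
qed

lemma additive_sum:
  fixes \<phi> :: "'a::comm_monoid_add \<Rightarrow> bit"
  assumes add: "\<And>x y. x \<in> V \<Longrightarrow> y \<in> V \<Longrightarrow> \<phi> (x + y) = \<phi> x + \<phi> y"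
    and V: "0 \<in> V" "\<And>x y. x \<in> V \<Longrightarrow> y \<in> V \<Longrightarrow> x + y \<in> V"
    and S: "finite S" "\<And>i. i \<in> S \<Longrightarrow> v i \<in> V"
  shows "(\<Sum>i\<in>S. v i) \<in> V \<and> \<phi> (\<Sum>i\<in>S. v i) = (\<Sum>i\<in>S. \<phi> (v i))"
  using S
proof (induction S rule: finite_induct)
  case empty
  have "\<phi> 0 = \<phi> 0 + \<phi> 0" using add[of 0 0] V(1) by simp
  then have "\<phi> 0 = 0" by (metis add_cancel_left_right)
  then show ?case using V(1) by simp
next
  case (insert i S)
  then show ?case using add V(2) by simp
qed

lemma sum_bit_eq_parity:
  fixes h :: "'a \<Rightarrow> bit"
  assumes "finite S"
  shows "(\<Sum>i\<in>S. h i) = of_bool (odd (card {i \<in> S. h i = 1}))"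
  using assms
proof (induction S rule: finite_induct)
  case (insert x S)
  have "{i \<in> insert x S. h i = 1} =
      (if h x = 1 then insert x {i \<in> S. h i = 1} else {i \<in> S. h i = 1})"
    by auto
  then show ?case using insert by (cases "h x") simp_all
qed simp

section \<open>The BCH queries\<close>

lemma nonadaptive_solvable_BCH:
  assumes "n < 2 ^ m"
  shows "nonadaptive_solvable n d (d * m)"
proof (cases "n = 0")
  case True
  then show ?thesis by (auto simp: nonadaptive_solvable_def candidates_def)
next
  case False
  with assms have m: "m > 0" by (cases m) auto
  have "CHAR(bit) = 2"
  proof (rule CHAR_eqI)
    show "2 dvd k" if "of_nat k = (0::bit)" for k
      using that by (metis even_of_nat dvd_0_right)
  qed simp
  then have char: "CHAR(bit alg_closure) = 2" by simp
  have double: "x + x = 0" for x :: "bit alg_closure"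
  proof -
    have "(of_nat 2 :: bit alg_closure) = 0"
      using char by (metis of_nat_CHAR)
    then show ?thesis
      by (metis mult_2 mult_zero_left of_nat_numeral)
  qed
  define K where "K = {x :: bit alg_closure. x ^ (2 ^ m) = x}"
  have cardK: "card K = 2 ^ m"
    unfolding K_def using char m by (rule card_frobenius_fixed)
  then have finK: "finite K" by (metis card.infinite power_not_zero zero_neq_numeral)
  have K0: "0 \<in> K" by (simp add: K_def)
  have K_add: "x + y \<in> K" if "x \<in> K" "y \<in> K" for x y
    using that freshmans_dream'[where 'a = "bit alg_closure" and n = m] char by (simp add: K_def)
  have K_pow: "x ^ j \<in> K" if "x \<in> K" for x j
    using that by (simp add: K_def) (metis power_mult mult.commute)
  have "\<exists>\<phi> :: nat \<Rightarrow> bit alg_closure \<Rightarrow> bit.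
      (\<forall>k. \<forall>x\<in>K. \<forall>y\<in>K. \<phi> k (x + y) = \<phi> k x + \<phi> k y) \<and>
      (\<forall>x\<in>K. \<forall>y\<in>K. (\<forall>k<m. \<phi> k x = \<phi> k y) \<longrightarrow> x = y)"
    using double finK eq_refl[OF cardK] K0 K_add by (rule binary_coordinates)
  then obtain \<phi> :: "nat \<Rightarrow> bit alg_closure \<Rightarrow> bit" where \<phi>_add: "\<forall>k. \<forall>x\<in>K. \<forall>y\<in>K. \<phi> k (x + y) = \<phi> k x + \<phi> k y"
    and \<phi>_inj: "\<forall>x\<in>K. \<forall>y\<in>K. (\<forall>k<m. \<phi> k x = \<phi> k y) \<longrightarrow> x = y"
    by (elim exE conjE)
  have "card {1..n} \<le> card (K - {0})"
    using assms finK K0 cardK by simp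
  then obtain a where a: "a ` {1..n} \<subseteq> K - {0}" "inj_on a {1..n}"
    using card_le_inj[of "{1..n}" "K - {0}"] finK by auto
  have a_pow: "a x ^ j \<in> K" if "x \<in> {1..n}" for x j
    using K_pow a(1) that by blast
  have sum_K: "(\<Sum>x\<in>S. a x ^ j) \<in> K \<and> \<phi> k (\<Sum>x\<in>S. a x ^ j) = (\<Sum>x\<in>S. \<phi> k (a x ^ j))"
    if "S \<subseteq> {1..n}" for S j k
  proof (rule additive_sum)
    show "finite S" using that finite_subset by blast
    show "a x ^ j \<in> K" if "x \<in> S" for x
      using a_pow that \<open>S \<subseteq> {1..n}\<close> by blast
    show "\<phi> k (x + y) = \<phi> k x + \<phi> k y" if "x \<in> K" "y \<in> K" for x y
      using \<phi>_add that by blast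
  qed (fact K0 K_add)+
  \<comment> \<open>Query number \<open>j * m + k + 1\<close> asks for coordinate \<open>k\<close> of the power sum with exponent \<open>2 * j + 1\<close>.\<close>
  define A where
    "A i = {x \<in> {1..n}. \<phi> ((i - 1) mod m) (a x ^ (2 * ((i - 1) div m) + 1)) = 1}" for i
  have answer: "parity_answer U (A (j * m + k + 1)) \<longleftrightarrow> \<phi> k (\<Sum>x\<in>U. a x ^ (2 * j + 1)) = 1"
    if "k < m" "U \<subseteq> {1..n}" for j k U
  proof -
    have finU: "finite U" using that(2) finite_subset by blast
    have "A (j * m + k + 1) \<inter> U = {x \<in> U. \<phi> k (a x ^ (2 * j + 1)) = 1}"
      using that by (auto simp: A_def)
    moreover have "\<phi> k (\<Sum>x\<in>U. a x ^ (2 * j + 1)) = (\<Sum>x\<in>U. \<phi> k (a x ^ (2 * j + 1)))"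
      using sum_K[OF that(2)] by blast
    ultimately show ?thesis
      by (simp add: parity_answer_def sum_bit_eq_parity[OF finU])
  qed
  show ?thesis
    unfolding nonadaptive_solvable_def
  proof (intro exI[of _ A] conjI ballI impI)
    fix U W assume UW: "U \<in> candidates n d" "W \<in> candidates n d" "U \<noteq> W"
    then have sub: "U \<subseteq> {1..n}" "W \<subseteq> {1..n}" and cards: "card U \<le> d" "card W \<le> d"
      by (auto simp: candidates_def)
    then have fin: "finite U" "finite W" by (auto intro: finite_subset)
    show "\<exists>i\<in>{1..d * m}. parity_answer U (A i) \<noteq> parity_answer W (A i)"
    proof (rule ccontr)
      assume "\<not> ?thesis"
      then have same: "parity_answer U (A i) = parity_answer W (A i)" if "i \<in> {1..d * m}" for i
        using that by blast
      have syndromes: "(\<Sum>x\<in>U. a x ^ (2 * j + 1)) = (\<Sum>x\<in>W. a x ^ (2 * j + 1))" if "j < d" for j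
      proof (rule \<phi>_inj[rule_format])
        show "(\<Sum>x\<in>U. a x ^ (2 * j + 1)) \<in> K" "(\<Sum>x\<in>W. a x ^ (2 * j + 1)) \<in> K"
          by (rule sum_K[OF sub(1), THEN conjunct1], rule sum_K[OF sub(2), THEN conjunct1])
        fix k assume "k < m"
        have "j * m + k + 1 \<le> (j + 1) * m" using \<open>k < m\<close> by simp
        also have "\<dots> \<le> d * m" using \<open>j < d\<close> by (intro mult_le_mono1) simp
        finally have "parity_answer U (A (j * m + k + 1)) = parity_answer W (A (j * m + k + 1))"
          by (intro same) (simp only: atLeastAtMost_iff, simp)
        then show "\<phi> k (\<Sum>x\<in>U. a x ^ (2 * j + 1)) = \<phi> k (\<Sum>x\<in>W. a x ^ (2 * j + 1))"
          unfolding answer[OF \<open>k < m\<close> sub(1)] answer[OF \<open>k < m\<close> sub(2)]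
          by (cases "\<phi> k (\<Sum>x\<in>U. a x ^ (2 * j + 1))";
              cases "\<phi> k (\<Sum>x\<in>W. a x ^ (2 * j + 1))") (simp_all only: bit.distinct simp_thms)
      qed
      define D where "D = sym_diff U W"
      have D: "D \<subseteq> {1..n}" "finite D" using sub fin by (auto simp: D_def)
      have inj: "inj_on a D" using a(2) D(1) by (rule inj_on_subset)
      have "a ` D = {}"
      proof (rule odd_power_sums_vanish_imp_empty[OF char])
        show "finite (a ` D)" using D(2) by simp
        show "0 \<notin> a ` D" using a(1) D(1) by blast
        have "card D \<le> card (U \<union> W)"
          using fin by (intro card_mono) (auto simp: D_def)
        also have "\<dots> \<le> 2 * d" using card_Un_le[of U W] cards by simp
        finally show "card (a ` D) \<le> 2 * d" using card_image[OF inj] by simp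
        fix j assume "j < d"
        define v where "v x = a x ^ (2 * j + 1)" for x
        have "(\<Sum>x\<in>U. v x) = (\<Sum>x\<in>U \<inter> W. v x) + (\<Sum>x\<in>U - W. v x)"
          using fin by (simp add: sum.Int_Diff)
        moreover have "(\<Sum>x\<in>W. v x) = (\<Sum>x\<in>U \<inter> W. v x) + (\<Sum>x\<in>W - U. v x)"
          using fin by (simp add: sum.Int_Diff[of W v U] Int_commute)
        ultimately have "(\<Sum>x\<in>U - W. v x) = (\<Sum>x\<in>W - U. v x)"
          using syndromes[OF \<open>j < d\<close>] by (simp add: v_def)
        moreover have "(\<Sum>x\<in>D. v x) = (\<Sum>x\<in>U - W. v x) + (\<Sum>x\<in>W - U. v x)"
          unfolding D_def using fin by (intro sum.union_disjoint) auto
        ultimately have "(\<Sum>x\<in>D. v x) = 0" by (simp add: double)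
        then show "(\<Sum>b\<in>a ` D. b ^ (2 * j + 1)) = 0"
          by (simp add: sum.reindex[OF inj] v_def)
      qed
      then show False using UW(3) by (auto simp: D_def)
    qed
  qed (auto simp: A_def)
qed

section \<open>Adaptive strategies\<close>

lemma nonadaptive_imp_adaptive_solvable:
  assumes "nonadaptive_solvable n d m"
  shows "adaptive_solvable n d m"
proof -
  obtain A where A: "\<forall>i\<in>{1..m}. A i \<subseteq> {1..n}"
    and sep: "\<forall>U\<in>candidates n d. \<forall>W\<in>candidates n d. U \<noteq> W \<longrightarrow>
           (\<exists>i\<in>{1..m}. parity_answer U (A i) \<noteq> parity_answer W (A i))"
    using assms unfolding nonadaptive_solvable_def by blast
  define T where "T = rec_nat Stop (\<lambda>k s. Ask (A (Suc k)) (\<lambda>_. s))"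
  have T: "T 0 = Stop" "T (Suc k) = Ask (A (Suc k)) (\<lambda>_. T k)" for k
    by (simp_all add: T_def)
  have within: "k \<le> m \<Longrightarrow> queries_within n (T k)" for k
    using A by (induction k) (auto simp: T)
  have len: "length (answers (T k) U) = k" for k U
    by (induction k) (auto simp: T)
  have det: "answers (T k) U = answers (T k) W \<Longrightarrow>
      \<forall>i\<in>{1..k}. parity_answer U (A i) = parity_answer W (A i)" for k U W
    by (induction k) (auto simp: T atLeastAtMostSuc_conv)
  have "inj_on (answers (T m)) (candidates n d)"
    using sep det[of m] by (meson inj_onI)
  then show ?thesis
    unfolding adaptive_solvable_def using within len by (metis order_refl)
qed

text \<open>
  Counting all answer lists of length at most \<open>m\<close>, rather than only the leaves of one decision tree,
  loses a factor of two. This costs a single query and so disappears in the bounded error term.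
\<close>

lemma adaptive_solvable_imp_binomial_less:
  assumes "adaptive_solvable n d m"
  shows "n choose d < 2 ^ (m + 1)"
proof -
  obtain s where len: "\<forall>U\<in>candidates n d. length (answers s U) \<le> m"
    and inj: "inj_on (answers s) (candidates n d)"
    using assms unfolding adaptive_solvable_def by blast
  define L where "L = {xs :: bool list. set xs \<subseteq> UNIV \<and> length xs \<le> m}"
  have finL: "finite L"
    unfolding L_def by (rule finite_lists_length_le) simp
  have "card L = (\<Sum>i\<le>m. 2 ^ i)"
    unfolding L_def by (subst card_lists_length_le) simp_all
  also have "\<dots> < 2 ^ (m + 1)"
    by (induction m) simp_all
  finally have cardL: "card L < 2 ^ (m + 1)" .
  have "n choose d = card {U. U \<subseteq> {1..n} \<and> card U = d}"
    by (simp add: n_subsets)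
  also have "\<dots> \<le> card (candidates n d)"
    by (intro card_mono) (auto simp: candidates_def)
  also have "\<dots> \<le> card L"
    using inj finL len by (intro card_inj_on_le) (auto simp: L_def)
  finally show ?thesis using cardL by simp
qed

section \<open>The asymptotics\<close>

lemma adaptive_number_le_nonadaptive_number: "adaptive_number n d \<le> nonadaptive_number n d"
proof -
  have "nonadaptive_solvable n d (nonadaptive_number n d)"
    unfolding nonadaptive_number_def by (rule LeastI) (rule nonadaptive_solvable_exists)
  then show ?thesis
    unfolding adaptive_number_def
    by (intro Least_le nonadaptive_imp_adaptive_solvable)
qed

lemma nonadaptive_number_upper:
  assumes "n > 0"
  shows "real (nonadaptive_number n d) \<le> real d * log 2 (real n) + real d"
proof -
  obtain k where k: "2 ^ k \<le> n" "n < 2 ^ (k + 1)"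
    using ex_power_ivl1[of 2 n] assms by auto
  have "nonadaptive_number n d \<le> d * (k + 1)"
    unfolding nonadaptive_number_def by (intro Least_le nonadaptive_solvable_BCH k(2))
  then have "real (nonadaptive_number n d) \<le> real (d * (k + 1))"
    by (rule of_nat_mono)
  also have "\<dots> = real d * real k + real d"
    by (simp add: algebra_simps)
  also have "real k \<le> log 2 (real n)"
    using le_log2_of_power[OF k(1)] .
  then have "real d * real k + real d \<le> real d * log 2 (real n) + real d"
    by (simp add: mult_left_mono)
  finally show ?thesis .
qed

lemma adaptive_number_lower:
  assumes "d > 0" "n \<ge> d"
  shows "real d * log 2 (real n) - real d * log 2 (real d) - 1 \<le> real (adaptive_number n d)"
proof -
  define g where "g = adaptive_number n d"
  have "adaptive_solvable n d g"
    unfolding g_def adaptive_number_def by (rule LeastI) (rule adaptive_solvable_exists)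
  then have "n choose d < 2 ^ (g + 1)"
    by (rule adaptive_solvable_imp_binomial_less)
  then have "real (n choose d) < 2 ^ (g + 1)"
    by (metis of_nat_less_iff of_nat_numeral of_nat_power)
  then have less: "(real n / real d) ^ d < 2 ^ (g + 1)"
    using binomial_ge_n_over_k_pow_k[OF \<open>n \<ge> d\<close>, where 'a = real] by linarith
  have pos: "real n / real d > 0" using assms by simp
  have "real d * log 2 (real n / real d) = log 2 ((real n / real d) ^ d)"
    using pos by (simp add: log_nat_power)
  also have "\<dots> \<le> log 2 (2 ^ (g + 1))"
    using less pos by (intro log_mono) auto
  also have "\<dots> = real (g + 1)"
    by (subst log_nat_power) simp_all
  finally show ?thesis
    using assms by (simp add: log_divide algebra_simps g_def)
qed

theorem mainTheorem2:
  fixes d :: nat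
  assumes "d > 0"
  shows "(\<lambda>n::nat. real (nonadaptive_number n d) - real d * log 2 (real n)) \<in> O[at_top](\<lambda>_. 1) \<and>
         (\<lambda>n::nat. real (adaptive_number n d) - real d * log 2 (real n)) \<in> O[at_top](\<lambda>_. 1)"
proof -
  define C where "C = real d + real d * log 2 (real d) + 1"
  have "real d * log 2 (real d) \<ge> 0" using assms by simp
  then have bound: "\<bar>real h - real d * log 2 (real n)\<bar> \<le> C"
    if "n \<ge> d" "adaptive_number n d \<le> h" "h \<le> nonadaptive_number n d" for n h
    using that assms adaptive_number_lower[of d n] nonadaptive_number_upper[of n d]
    unfolding C_def by linarith
  have "(\<lambda>n. real (h n) - real d * log 2 (real n)) \<in> O[at_top](\<lambda>_. 1)"
    if h: "\<And>n. adaptive_number n d \<le> h n" "\<And>n. h n \<le> nonadaptive_number n d" for h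
    using bound[OF _ h]
    by (intro bigoI[of _ C] eventually_mono[OF eventually_ge_at_top[of d]]) simp
  then show ?thesis
    using adaptive_number_le_nonadaptive_number by simp
qed

end
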